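(* For every infinite cardinal $\kappa$ there is a $0$-dimensional $T_2$ topological space $X$ with dispersion character $\Delta(X)=\kappa$ such that $X$ is extraresolvable but not $\omega_1$-resolvable.
   Context: For a topological space $X$, the dispersion character of $X$ is $\Delta(X)=\min\{|G| : G\subset X \text{ open},\ G\neq\emptyset\}$. For a cardinal $\lambda$, the space $X$ is called $\lambda$-resolvable if it contains $\lambda$ many dense subsets that are pairwise disjoint. The space $X$ is called extraresolvable if it has $\Delta(X)^+$ many dense subsets (where $\Delta(X)^+$ is the successor cardinal of $\Delta(X)$) such that any two of them have nowhere dense intersection in $X$. A space is $0$-dimensional if it has a base consisting of clopen sets. *)

theory Defs
  imports "HOL-Analysis.Analysis"
begin

unbundle cardinal_syntax

definition dense_in :: "'a topology \<Rightarrow> 'a set \<Rightarrow> bool" where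
  "dense_in X D \<longleftrightarrow> D \<subseteq> topspace X \<and> X closure_of D = topspace X"

definition nowhere_dense_in :: "'a topology \<Rightarrow> 'a set \<Rightarrow> bool" where
  "nowhere_dense_in X N \<longleftrightarrow> N \<subseteq> topspace X \<and> X interior_of (X closure_of N) = {}"

definition zero_dimensional :: "'a topology \<Rightarrow> bool" where
  "zero_dimensional X \<longleftrightarrow>
     (\<exists>\<B>. (\<forall>B\<in>\<B>. openin X B \<and> closedin X B) \<and> openin X = arbitrary union_of (\<lambda>B. B \<in> \<B>))"

(* Cardinals are represented by well-orders as in the library theory of cardinal orders, so the
   minimum is the cardinal |G| of some nonempty open G of least cardinality; it is determined
   up to =o. As for any minimum over an empty family, the value is unspecified if X has no
   points. *)
definition dispersion_character :: "'a topology \<Rightarrow> 'a rel" where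
  "dispersion_character X =
     |SOME G. openin X G \<and> G \<noteq> {} \<and> (\<forall>H. openin X H \<and> H \<noteq> {} \<longrightarrow> |G| \<le>o |H| )|"

definition resolvable :: "'b rel \<Rightarrow> 'a topology \<Rightarrow> bool" where
  "resolvable \<mu> X \<longleftrightarrow>
     (\<exists>\<D>. |\<D>| =o \<mu> \<and> (\<forall>D\<in>\<D>. dense_in X D) \<and> pairwise disjnt \<D>)"

definition extraresolvable :: "'a topology \<Rightarrow> bool" where
  "extraresolvable X \<longleftrightarrow>
     (\<exists>\<D>. |\<D>| =o cardSuc (dispersion_character X) \<and> (\<forall>D\<in>\<D>. dense_in X D) \<and>
          pairwise (\<lambda>D E. nowhere_dense_in X (D \<inter> E)) \<D>)"

abbreviation omega_1 :: "nat set rel" where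
  "omega_1 \<equiv> cardSuc natLeq"

(* The minimum exists for every space with points and has the expected characterization. *)
lemma dispersion_character_witness:
  assumes "topspace X \<noteq> {}"
  obtains G where "openin X G" "G \<noteq> {}" "dispersion_character X = |G|"
    "\<And>H. openin X H \<Longrightarrow> H \<noteq> {} \<Longrightarrow> dispersion_character X \<le>o |H|"
proof -
  let ?P = "\<lambda>G. openin X G \<and> G \<noteq> {} \<and> (\<forall>H. openin X H \<and> H \<noteq> {} \<longrightarrow> |G| \<le>o |H| )"
  let ?R = "card_of ` {G. openin X G \<and> G \<noteq> {}}"
  have "topspace X \<in> {G. openin X G \<and> G \<noteq> {}}"
    using assms by simp
  then have ne: "?R \<noteq> {}"
    by (metis empty_iff image_is_empty)
  have wo: "\<forall>r\<in>?R. Well_order r"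
    by (metis (no_types, lifting) card_of_Well_order imageE)
  have "\<exists>r\<in>?R. \<forall>r'\<in>?R. r \<le>o r'"
    by (rule exists_minim_Well_order[OF ne wo])
  then have "\<exists>G. ?P G"
    by (simp only: bex_simps ball_simps mem_Collect_eq) metis
  then have "?P (SOME G. ?P G)" by (rule someI_ex)
  then show thesis
    using that[of "SOME G. ?P G"] by (simp add: dispersion_character_def)
qed

end

theory Submission
  imports Defs "HOL-Library.Countable_Set_Type"
begin

text \<open>
  Let \<open>X\<close> have cardinality \<open>\<kappa>\<close>, and take an independent family on \<open>X\<close> all of whose cells have
  size \<open>\<kappa>\<close>. One part of it, \<open>D \<alpha>\<close> for \<open>\<alpha> \<subseteq> X\<close>, will become the dense sets; the other part provides
  for every \<open>B \<subseteq> X\<close> infinitely many coordinates reserved for \<open>B\<close>. \<^emph>\<open>Killing\<close> \<open>B\<close> means removing \<open>B\<close> from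
  its reserved coordinates, which makes \<open>B\<close> nowhere dense in the topology in which the coordinates
  are declared clopen. By Zorn's lemma there is a maximal collection \<open>\<A>\<close> of killed sets that contains
  all \<open>D \<alpha> \<inter> D \<beta>\<close> and for which every cell, even after deleting the killed sets whose reserved
  coordinates it mentions, still has size \<open>\<kappa>\<close>; only cells that are compatible with killing the sets
  \<open>D \<alpha> \<inter> D \<beta>\<close> are considered. Hence the sets \<open>D \<alpha>\<close> are dense with pairwise nowhere dense intersections.

  A dense set is not killed, so by maximality it contains such a reduced cell up to fewer than \<open>\<kappa>\<close>
  points. Two compatible cells have a reduced cell, of size \<open>\<kappa>\<close>, in common, and among uncountably
  many cells two are compatible because finite partial functions into a two-element set satisfy the
  countable chain condition. So an uncountable family of dense sets is not disjoint.
\<close>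

section \<open>Countable chain condition for finite partial functions\<close>

lemma uncountable_fiber:
  assumes "uncountable T" and "countable (f ` T)"
  obtains y where "uncountable {t \<in> T. f t = y}"
proof -
  have "countable T" if "\<And>y. countable {t \<in> T. f t = y}"
  proof -
    have "countable (\<Union>y\<in>f ` T. {t \<in> T. f t = y})"
      using assms(2) that by (intro countable_UN) auto
    moreover have "(\<Union>y\<in>f ` T. {t \<in> T. f t = y}) = T"
      by auto
    ultimately show ?thesis
      by simp
  qed
  then show thesis
    using that assms(1) by blast
qed

text \<open>Induction on the domain size \<open>n\<close>. If no two indices were compatible, every
  other \<open>t\<close> would conflict with a fixed \<open>r\<close> at one of the finitely many
  points of its domain. Uncountably many \<open>t\<close> share such a point, and deleting it lowers
  \<open>n\<close> by one.\<close>

lemma compatible_pair_same_size: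
  assumes "uncountable T"
    and "\<And>t. t \<in> T \<Longrightarrow> finite (p t) \<and> finite (q t) \<and> p t \<inter> q t = {} \<and> card (p t \<union> q t) = n"
  shows "\<exists>s\<in>T. \<exists>t\<in>T. s \<noteq> t \<and> p s \<inter> q t = {} \<and> p t \<inter> q s = {}"
  using assms
proof (induction n arbitrary: T p q)
  case 0
  then have empty: "p t = {} \<and> q t = {}" if "t \<in> T" for t
    using that by fastforce
  obtain s where s: "s \<in> T"
    using "0.prems"(1) by fastforce
  have "T \<noteq> {s}"
    using "0.prems"(1) by auto
  then obtain t where "t \<in> T" "s \<noteq> t"
    using s by blast
  then show ?case
    using s empty by blast
next
  case (Suc n)
  show ?case
  proof (rule ccontr)
    assume neg: "\<not> ?thesis"
    obtain r where r: "r \<in> T"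
      using Suc.prems(1) by fastforce
    \<comment> \<open>The conflicts of \<open>t\<close> with \<open>r\<close>. The Boolean records
      on which side of \<open>t\<close> the point lies, so that indices with the same tag agree at
      \<open>x\<close> and restoring \<open>x\<close> creates no conflict.\<close>
    define K where "K t = {True} \<times> (p t \<inter> q r) \<union> {False} \<times> (q t \<inter> p r)" for t
    define f where "f t = (SOME z. z \<in> K t)" for t
    have f: "f t \<in> K t" if "t \<in> T - {r}" for t
    proof -
      have "p t \<inter> q r \<noteq> {} \<or> q t \<inter> p r \<noteq> {}"
        using neg r that by blast
      then have "K t \<noteq> {}"
        unfolding K_def by blast
      then show ?thesis
        unfolding f_def by (simp add: some_in_eq)
    qed
    have "K t \<subseteq> UNIV \<times> (p r \<union> q r)" for t
      unfolding K_def by blast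
    then have "f ` (T - {r}) \<subseteq> UNIV \<times> (p r \<union> q r)"
      using f by blast
    moreover have "finite (UNIV \<times> (p r \<union> q r) :: (bool \<times> _) set)"
      using Suc.prems(2)[OF r] by simp
    ultimately have "countable (f ` (T - {r}))"
      using finite_subset countable_finite by metis
    moreover have "uncountable (T - {r})"
      using Suc.prems(1) by (simp add: uncountable_minus_countable)
    ultimately obtain z where z: "uncountable {t \<in> T - {r}. f t = z}"
      using uncountable_fiber by blast
    obtain b x where bx: "z = (b, x)"
      by fastforce
    let ?T = "{t \<in> T - {r}. f t = z}"
    have mem: "if b then x \<in> p t else x \<in> q t" if "t \<in> ?T" for t
      using f[of t] that unfolding bx K_def by auto
    have "\<exists>s\<in>?T. \<exists>t\<in>?T. s \<noteq> t \<and> (p s - {x}) \<inter> (q t - {x}) = {} \<and> (p t - {x}) \<inter> (q s - {x}) = {}"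
    proof (rule Suc.IH[OF z])
      fix t assume t: "t \<in> ?T"
      then have "x \<in> p t \<union> q t"
        using mem[OF t] by (cases b) auto
      moreover have "(p t - {x}) \<union> (q t - {x}) = p t \<union> q t - {x}"
        by blast
      ultimately show "finite (p t - {x}) \<and> finite (q t - {x}) \<and> (p t - {x}) \<inter> (q t - {x}) = {}
          \<and> card ((p t - {x}) \<union> (q t - {x})) = n"
        using Suc.prems(2)[of t] t by auto
    qed
    then obtain s t where st: "s \<in> ?T" "t \<in> ?T" "s \<noteq> t"
      "(p s - {x}) \<inter> (q t - {x}) = {}" "(p t - {x}) \<inter> (q s - {x}) = {}"
      by blast
    have "p s \<inter> q t = {} \<and> p t \<inter> q s = {}"
      using st mem[OF st(1)] mem[OF st(2)] Suc.prems(2)[of s] Suc.prems(2)[of t]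
      by (cases b) auto
    then show False
      using neg st by blast
  qed
qed

lemma compatible_pair:
  assumes "uncountable T"
    and "\<And>t. t \<in> T \<Longrightarrow> finite (p t) \<and> finite (q t) \<and> p t \<inter> q t = {}"
  shows "\<exists>s\<in>T. \<exists>t\<in>T. s \<noteq> t \<and> p s \<inter> q t = {} \<and> p t \<inter> q s = {}"
proof -
  obtain n where "uncountable {t \<in> T. card (p t \<union> q t) = n}"
    using uncountable_fiber[OF assms(1), of "\<lambda>t. card (p t \<union> q t)"] by auto
  then have "\<exists>s\<in>{t \<in> T. card (p t \<union> q t) = n}. \<exists>t\<in>{t \<in> T. card (p t \<union> q t) = n}.
      s \<noteq> t \<and> p s \<inter> q t = {} \<and> p t \<inter> q s = {}"
    by (rule compatible_pair_same_size) (use assms(2) in simp)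
  then show ?thesis
    by blast
qed

section \<open>Cells and independent families\<close>

definition cell :: "'a set \<Rightarrow> ('i \<Rightarrow> 'a set) \<Rightarrow> 'i set \<Rightarrow> 'i set \<Rightarrow> 'a set" where
  "cell X C P N = {x \<in> X. (\<forall>i\<in>P. x \<in> C i) \<and> (\<forall>i\<in>N. x \<notin> C i)}"

text \<open>One point from the symmetric difference of each pair of distinct members
  suffices.\<close>

lemma finite_separating_set:
  fixes \<A> :: "'a set set"
  assumes "finite \<A>"
  obtains s where "finite s" "s \<subseteq> \<Union>\<A>" "inj_on (\<lambda>A. A \<inter> s) \<A>"
proof -
  define d where "d = (\<lambda>(A, B :: 'a set). SOME x. x \<in> (A - B) \<union> (B - A))"
  define K where "K = {z \<in> \<A> \<times> \<A>. fst z \<noteq> snd z}"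
  have d: "d (A, B) \<in> (A - B) \<union> (B - A)" if "A \<noteq> B" for A B :: "'a set"
  proof -
    have "\<exists>x. x \<in> (A - B) \<union> (B - A)"
      using that by blast
    then show ?thesis
      unfolding d_def prod.case by (rule someI_ex)
  qed
  show thesis
  proof
    show "finite (d ` K)"
      using assms unfolding K_def by simp
    show "d ` K \<subseteq> \<Union>\<A>"
    proof (rule image_subsetI)
      fix z assume "z \<in> K"
      then have AB: "fst z \<in> \<A>" "snd z \<in> \<A>" "fst z \<noteq> snd z"
        unfolding K_def by auto
      have "d z \<in> fst z \<union> snd z"
        using d[OF AB(3)] by auto
      then show "d z \<in> \<Union>\<A>"
        using AB by blast
    qed
    show "inj_on (\<lambda>A. A \<inter> d ` K) \<A>"
    proof (rule inj_onI, rule ccontr)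
      fix A B assume AB: "A \<in> \<A>" "B \<in> \<A>" "A \<inter> d ` K = B \<inter> d ` K" "A \<noteq> B"
      then have "(A, B) \<in> K"
        unfolding K_def by simp
      then have "d (A, B) \<in> d ` K"
        by (rule imageI)
      moreover have "d (A, B) \<in> A \<inter> d ` K \<longleftrightarrow> d (A, B) \<in> B \<inter> d ` K"
        unfolding AB(3) ..
      ultimately have "d (A, B) \<in> A \<longleftrightarrow> d (A, B) \<in> B"
        by blast
      then show False
        using d[OF AB(4)] by simp
    qed
  qed
qed

text \<open>A set of size \<open>n + 1\<close> arises by inserting a point into one of size
  \<open>n\<close>, so by induction there are at most \<open>|X|\<close> sets of each size, and
  there are only countably many sizes.\<close>

lemma card_of_Fpow_ordLeq:
  assumes inf: "infinite X"
  shows "|Fpow X| \<le>o |X|"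
proof -
  let ?F = "\<lambda>n. {A. A \<subseteq> X \<and> finite A \<and> card A = n}"
  have F: "|?F n| \<le>o |X|" for n
  proof (induction n)
    case 0
    have "?F 0 \<subseteq> {{}}"
      by auto
    then have "finite (?F 0)"
      by (rule finite_subset) simp
    then show ?case
      using inf card_of_ordLeq_infinite ordLeq_total card_of_Well_order by metis
  next
    case (Suc n)
    have "?F (Suc n) \<subseteq> (\<lambda>(x, A). insert x A) ` (X \<times> ?F n)"
    proof
      fix A assume A: "A \<in> ?F (Suc n)"
      then obtain x B where "A = insert x B" "x \<notin> B" "card B = n" "finite B"
        by (auto simp: card_Suc_eq_finite)
      with A show "A \<in> (\<lambda>(x, A). insert x A) ` (X \<times> ?F n)"
        by (intro image_eqI[of _ _ "(x, B)"]) auto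
    qed
    then have "|?F (Suc n)| \<le>o |X \<times> ?F n|"
      by (meson card_of_image card_of_mono1 ordLeq_transitive)
    moreover have "|X \<times> ?F n| \<le>o |X|"
      using inf Suc.IH by (intro card_of_Times_ordLeq_infinite_Field) (simp_all add: Field_card_of card_of_mono1 card_of_card_order_on)
    ultimately show ?case
      by (rule ordLeq_transitive)
  qed
  have "|UNIV :: nat set| \<le>o |X|"
    using inf infinite_iff_card_of_nat by blast
  then have "|\<Union>n. ?F n| \<le>o |X|"
    using inf F by (intro card_of_UNION_ordLeq_infinite) auto
  moreover have "Fpow X = (\<Union>n. ?F n)"
    unfolding Fpow_def by blast
  ultimately show ?thesis
    by simp
qed

lemma finite_diff_ordLeq:
  assumes "infinite A" "finite B" "|A| \<le>o |C|"
  shows "|A| \<le>o |C - B|"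
proof -
  have "\<not> |C - B| <o |A|"
  proof
    assume "|C - B| <o |A|"
    moreover have "|B| <o |A|"
      using assms by (intro finite_ordLess_infinite) (simp_all add: Field_card_of card_of_well_order_on)
    ultimately have "|(C - B) \<union> B| <o |A|"
      using assms(1) by (intro card_of_Un_ordLess_infinite)
    moreover have "|C| \<le>o |(C - B) \<union> B|"
      by (rule card_of_mono1) blast
    ultimately show False
      using assms(3) by (meson not_ordLess_ordLeq ordLeq_ordLess_trans)
  qed
  then show ?thesis
    using not_ordLess_iff_ordLeq[OF card_of_Well_order card_of_Well_order] by blast
qed

text \<open>Hausdorff's independent family, on the set of pairs of a finite subset \<open>s\<close> of \<open>X\<close> and a
  finite set \<open>U\<close> of such subsets.\<close>

lemma independent_family:
  fixes X :: "'a set"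
  assumes inf: "infinite X"
  shows "\<exists>C :: 'a set \<Rightarrow> 'a set. \<forall>P N. finite P \<longrightarrow> finite N \<longrightarrow> P \<union> N \<subseteq> Pow X
    \<longrightarrow> P \<inter> N = {} \<longrightarrow> |X| \<le>o |cell X C P N|"
proof -
  define T where "T = Fpow X \<times> Fpow (Fpow X)"
  have "inj_on (\<lambda>x. {x}) X" "(\<lambda>x. {x}) ` X \<subseteq> Fpow X"
    by (auto simp: Fpow_def)
  then have FX: "infinite (Fpow X)"
    using inf inj_on_finite by metis
  have "|Fpow (Fpow X)| \<le>o |X|"
    using card_of_Fpow_ordLeq[OF FX] card_of_Fpow_ordLeq[OF inf] by (rule ordLeq_transitive)
  then have "|T| \<le>o |X|"
    unfolding T_def using inf card_of_Fpow_ordLeq[OF inf]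
    by (intro card_of_Times_ordLeq_infinite_Field) (simp_all add: Field_card_of card_of_mono1 card_of_card_order_on)
  \<comment> \<open>\<open>e\<close> codes the pairs as points of \<open>X\<close>, which moves
    Hausdorff's family to \<open>X\<close> itself.\<close>
  then obtain e where e: "inj_on e T" "e ` T \<subseteq> X"
    using card_of_ordLeq by metis
  define C where "C A = e ` {(s, U) \<in> T. A \<inter> s \<in> U}" for A
  show ?thesis
  proof (intro exI allI impI)
    fix P N :: "'a set set"
    assume fin: "finite P" "finite N" and sub: "P \<union> N \<subseteq> Pow X" and dis: "P \<inter> N = {}"
    obtain s where s: "finite s" "s \<subseteq> \<Union>(P \<union> N)" "inj_on (\<lambda>A. A \<inter> s) (P \<union> N)"
      using finite_separating_set[of "P \<union> N"] fin by blast
    have sX: "s \<subseteq> X"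
      using s(2) sub by blast
    \<comment> \<open>Every \<open>x\<close> outside \<open>s\<close> yields a point of the cell:
      \<open>insert x s\<close> still separates the members of \<open>P \<union> N\<close>, and the
      second component consists of the traces of \<open>P\<close> only. Different \<open>x\<close>
      give different codes.\<close>
    define g where "g x = e (insert x s, (\<lambda>A. A \<inter> insert x s) ` P)" for x
    have inT: "(insert x s, (\<lambda>A. A \<inter> insert x s) ` P) \<in> T" if "x \<in> X" for x
      using that sX s(1) fin(1) unfolding T_def Fpow_def by auto
    have "inj_on g (X - s)"
    proof (rule inj_onI)
      fix x y assume xy: "x \<in> X - s" "y \<in> X - s" "g x = g y"
      then have "insert x s = insert y s"
        using inj_onD[OF e(1) _ inT inT, of x y] unfolding g_def by simp
      then show "x = y"
        using xy by blast
    qed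
    moreover have "g ` (X - s) \<subseteq> cell X C P N"
    proof safe
      fix x assume x: "x \<in> X" "x \<notin> s"
      have mem: "g x \<in> C A \<longleftrightarrow> A \<inter> insert x s \<in> (\<lambda>A. A \<inter> insert x s) ` P" for A
        unfolding C_def g_def
        using inj_on_image_mem_iff[OF e(1) inT[OF x(1)], of "{(s, U) \<in> T. A \<inter> s \<in> U}"] inT[OF x(1)]
        by auto
      have "g x \<notin> C A" if "A \<in> N" for A
      proof
        assume "g x \<in> C A"
        then obtain B where "B \<in> P" "A \<inter> insert x s = B \<inter> insert x s"
          using mem by blast
        then have "A \<inter> s = B \<inter> s" "B \<in> P"
          by blast+
        then have "A = B"
          using s(3) that by (meson UnCI inj_onD)
        then show False
          using dis that \<open>B \<in> P\<close> by blast
      qed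
      moreover have "g x \<in> X"
        using e(2) inT[OF x(1)] unfolding g_def by (metis image_subset_iff)
      moreover have "g x \<in> C A" if "A \<in> P" for A
        using mem that by (metis imageI)
      ultimately show "g x \<in> cell X C P N"
        by (simp add: cell_def)
    qed
    ultimately have "|X - s| \<le>o |cell X C P N|"
      using card_of_ordLeq by blast
    moreover have "|X| \<le>o |X - s|"
      using inf s(1) by (intro finite_diff_ordLeq ordLeq_refl) (simp_all add: Field_card_of card_of_mono1 card_of_card_order_on)
    ultimately show "|X| \<le>o |cell X C P N|"
      using ordLeq_transitive by blast
  qed
qed

lemma cell_Int: "cell X C P N \<inter> cell X C P' N' = cell X C (P \<union> P') (N \<union> N')"
  by (auto simp: cell_def)

text \<open>\<open>C (Inl \<alpha>)\<close> is the set \<open>D \<alpha>\<close>, and \<open>C (Inr (B, x, y))\<close> are the coordinates reserved for \<open>B\<close>. The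
  coordinates reserved for the empty set are never changed and can therefore separate points.\<close>

locale separating_independent_sets =
  fixes X :: "'a set" and C :: "'a set + 'a set \<times> 'a \<times> 'a \<Rightarrow> 'a set"
  assumes infinite: "infinite X"
    and subset: "C i \<subseteq> X"
    and independent: "finite P \<Longrightarrow> finite N \<Longrightarrow> P \<union> N \<subseteq> Pow X <+> Pow X \<times> X \<times> X
      \<Longrightarrow> P \<inter> N = {} \<Longrightarrow> |X| \<le>o |cell X C P N|"
    and separating: "x \<in> X \<Longrightarrow> y \<in> X \<Longrightarrow> x \<noteq> y
      \<Longrightarrow> x \<in> C (Inr ({}, x, y)) \<and> y \<notin> C (Inr ({}, x, y))"

text \<open>Coordinates of an independent family may be altered at finitely many points each: a cell
  uses finitely many coordinates, so it keeps size \<open>|X|\<close> after the altered points are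
  deleted.\<close>

lemma separating_independent_sets_exist:
  fixes X :: "'a set"
  assumes inf: "infinite X"
  shows "\<exists>C. separating_independent_sets X C"
proof -
  let ?I = "Pow X <+> Pow X \<times> X \<times> X"
  from independent_family[OF inf] obtain C0 :: "'a set \<Rightarrow> 'a set" where C0:
    "\<forall>P N. finite P \<longrightarrow> finite N \<longrightarrow> P \<union> N \<subseteq> Pow X \<longrightarrow> P \<inter> N = {}
      \<longrightarrow> |X| \<le>o |cell X C0 P N|"
    by (rule exE)
  have "|X| \<le>o |Pow X|"
    by (rule ordLess_imp_ordLeq[OF card_of_Pow])
  then have "|?I| \<le>o |Pow X|"
    using inf
    by (intro card_of_Plus_ordLeq_infinite_Field card_of_Times_ordLeq_infinite_Field)
      (simp_all add: Field_card_of card_of_mono1 card_of_card_order_on)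
  then obtain h where h: "inj_on h ?I" "h ` ?I \<subseteq> Pow X"
    using card_of_ordLeq by metis
  define C where "C i = X \<inter> (case i of Inr (B, x, y) \<Rightarrow>
      if B = {} then insert x (C0 (h i)) - {y} else C0 (h i) | Inl _ \<Rightarrow> C0 (h i))" for i
  \<comment> \<open>Within \<open>X\<close>, the sets \<open>C i\<close> and \<open>C0 (h i)\<close>
    can differ only at points of \<open>E i\<close>.\<close>
  define E where "E i = (case i of Inr (_, x, y) \<Rightarrow> {x, y} | Inl _ \<Rightarrow> {})"
    for i :: "'a set + 'a set \<times> 'a \<times> 'a"
  have C: "z \<in> C i \<longleftrightarrow> z \<in> C0 (h i)" if "z \<in> X" "z \<notin> E i" for z i
    using that unfolding C_def E_def by (auto split: sum.splits)
  have "separating_independent_sets X C"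
  proof (rule separating_independent_sets.intro[OF inf])
    show "C i \<subseteq> X" for i
      by (simp add: C_def)
    show "x \<in> C (Inr ({}, x, y)) \<and> y \<notin> C (Inr ({}, x, y))" if "x \<in> X" "y \<in> X" "x \<noteq> y" for x y
      using that by (simp add: C_def)
    fix P N assume fin: "finite P" "finite N" and sub: "P \<union> N \<subseteq> ?I" and dis: "P \<inter> N = {}"
    let ?A = "cell X C0 (h ` P) (h ` N)"
    have "h ` P \<inter> h ` N = {}"
      using h(1) sub dis by (metis Un_subset_iff image_empty inj_on_image_Int)
    moreover have "h ` P \<union> h ` N \<subseteq> Pow X"
      using h(2) sub by blast
    ultimately have A: "|X| \<le>o |?A|"
      by (intro C0[rule_format] finite_imageI fin)
    have "finite (\<Union>i\<in>P \<union> N. E i)"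
      using fin by (auto simp: E_def split: sum.splits)
    then have "|X| \<le>o |?A - (\<Union>i\<in>P \<union> N. E i)|"
      using inf A by (intro finite_diff_ordLeq)
    moreover have "?A - (\<Union>i\<in>P \<union> N. E i) \<subseteq> cell X C P N"
      using C unfolding cell_def by auto
    ultimately show "|X| \<le>o |cell X C P N|"
      by (meson card_of_mono1 ordLeq_transitive)
  qed
  then show ?thesis
    by (intro exI)
qed

section \<open>Topologies with prescribed clopen coordinates\<close>

text \<open>The topology on \<open>X\<close> generated by the traces of the sets \<open>V i\<close>,
  \<open>i \<in> I\<close>, and of their complements. Cells are closed under finite intersections,
  so they form a base.\<close>

definition cell_topology :: "'a set \<Rightarrow> 'i set \<Rightarrow> ('i \<Rightarrow> 'a set) \<Rightarrow> 'a topology" where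
  "cell_topology X I V = topology (arbitrary union_of
    (\<lambda>U. \<exists>P N. finite P \<and> finite N \<and> P \<union> N \<subseteq> I \<and> U = cell X V P N))"

lemma openin_cell_topology:
  "openin (cell_topology X I V) = arbitrary union_of
    (\<lambda>U. \<exists>P N. finite P \<and> finite N \<and> P \<union> N \<subseteq> I \<and> U = cell X V P N)"
  unfolding cell_topology_def
proof (intro topology_inverse' istopology_base)
  fix S T
  assume "\<exists>P N. finite P \<and> finite N \<and> P \<union> N \<subseteq> I \<and> S = cell X V P N"
    and "\<exists>P N. finite P \<and> finite N \<and> P \<union> N \<subseteq> I \<and> T = cell X V P N"
  then obtain P N P' N' where "finite P" "finite N" "P \<union> N \<subseteq> I" "S = cell X V P N"
    "finite P'" "finite N'" "P' \<union> N' \<subseteq> I" "T = cell X V P' N'"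
    by auto
  then show "\<exists>P N. finite P \<and> finite N \<and> P \<union> N \<subseteq> I \<and> S \<inter> T = cell X V P N"
    by (intro exI[of _ "P \<union> P'"] exI[of _ "N \<union> N'"]) (auto simp: cell_Int)
qed

lemma openin_cell:
  assumes "finite P" "finite N" "P \<union> N \<subseteq> I"
  shows "openin (cell_topology X I V) (cell X V P N)"
  unfolding openin_cell_topology using assms by (intro union_of_inc) (auto simp: arbitrary_def)

lemma topspace_cell_topology [simp]: "topspace (cell_topology X I V) = X"
proof
  show "topspace (cell_topology X I V) \<subseteq> X"
    unfolding topspace_def openin_cell_topology by (auto simp: union_of_def cell_def)
  have "openin (cell_topology X I V) X"
    using openin_cell[of "{}" "{}" I X V] by (simp add: cell_def)
  then show "X \<subseteq> topspace (cell_topology X I V)"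
    by (rule openin_subset)
qed

text \<open>A cell with a point has \<open>P \<inter> N = {}\<close>; this is recorded because the
  size estimates for cells assume it.\<close>

lemma cell_topology_neighbourhood:
  assumes "openin (cell_topology X I V) U" and "x \<in> U"
  obtains P N where "finite P" "finite N" "P \<union> N \<subseteq> I" "P \<inter> N = {}" "x \<in> cell X V P N"
    "cell X V P N \<subseteq> U"
proof -
  have "\<exists>B. (\<exists>P N. finite P \<and> finite N \<and> P \<union> N \<subseteq> I \<and> B = cell X V P N) \<and> x \<in> B \<and> B \<subseteq> U"
    using openin_topology_base_unique[THEN iffD1, OF openin_cell_topology, THEN conjunct2,
        rule_format, of X I V U x] assms by simp
  then obtain P N where "finite P" "finite N" "P \<union> N \<subseteq> I" "x \<in> cell X V P N" "cell X V P N \<subseteq> U"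
    by blast
  moreover from this have "P \<inter> N = {}"
    by (auto simp: cell_def)
  ultimately show thesis
    using that by blast
qed

lemma closedin_cell:
  assumes "finite P" "finite N" "P \<union> N \<subseteq> I"
  shows "closedin (cell_topology X I V) (cell X V P N)"
proof -
  have "X - cell X V P N = (\<Union>i\<in>P. cell X V {} {i}) \<union> (\<Union>i\<in>N. cell X V {i} {})"
    by (auto simp: cell_def)
  moreover have "openin (cell_topology X I V) (cell X V {} {i})" if "i \<in> P" for i
    using that assms by (intro openin_cell) auto
  moreover have "openin (cell_topology X I V) (cell X V {i} {})" if "i \<in> N" for i
    using that assms by (intro openin_cell) auto
  ultimately have "openin (cell_topology X I V) (X - cell X V P N)"
    by (metis (no_types, lifting) openin_Un openin_clauses(3) imageE)
  moreover have "cell X V P N \<subseteq> X"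
    by (auto simp: cell_def)
  ultimately show ?thesis
    by (simp add: closedin_def)
qed

lemma zero_dimensional_cell_topology: "zero_dimensional (cell_topology X I V)"
  unfolding zero_dimensional_def
proof (intro exI conjI ballI)
  let ?B = "{U. \<exists>P N. finite P \<and> finite N \<and> P \<union> N \<subseteq> I \<and> U = cell X V P N}"
  show "openin (cell_topology X I V) B" "closedin (cell_topology X I V) B" if "B \<in> ?B" for B
    using that by (auto intro: openin_cell closedin_cell)
  show "openin (cell_topology X I V) = arbitrary union_of (\<lambda>B. B \<in> ?B)"
    by (simp add: openin_cell_topology)
qed

lemma Hausdorff_cell_topology:
  assumes "\<And>x y. x \<in> X \<Longrightarrow> y \<in> X \<Longrightarrow> x \<noteq> y \<Longrightarrow> \<exists>i\<in>I. x \<in> V i \<and> y \<notin> V i"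
  shows "Hausdorff_space (cell_topology X I V)"
  unfolding Hausdorff_space_def
proof (intro allI impI, elim conjE)
  fix x y assume "x \<in> topspace (cell_topology X I V)" "y \<in> topspace (cell_topology X I V)" "x \<noteq> y"
  then obtain i where i: "i \<in> I" "x \<in> V i" "y \<notin> V i" "x \<in> X" "y \<in> X"
    using assms by auto
  then have "openin (cell_topology X I V) (cell X V {i} {})" "openin (cell_topology X I V) (cell X V {} {i})"
    by (simp_all add: openin_cell)
  moreover have "x \<in> cell X V {i} {}" "y \<in> cell X V {} {i}" "disjnt (cell X V {i} {}) (cell X V {} {i})"
    using i by (auto simp: cell_def disjnt_def)
  ultimately show "\<exists>U W. openin (cell_topology X I V) U \<and> openin (cell_topology X I V) W
      \<and> x \<in> U \<and> y \<in> W \<and> disjnt U W"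
    by blast
qed

section \<open>Criteria for dispersion character, density and nowhere density\<close>

lemma dispersion_character_eq:
  assumes "topspace T \<noteq> {}"
    and "\<And>U. openin T U \<Longrightarrow> U \<noteq> {} \<Longrightarrow> |topspace T| \<le>o |U|"
  shows "dispersion_character T =o |topspace T|"
  using dispersion_character_witness[OF assms(1)]
  by (metis assms openin_topspace ordIso_iff_ordLeq)

lemma dense_inI:
  assumes "D \<subseteq> topspace T" and "\<And>U. openin T U \<Longrightarrow> U \<noteq> {} \<Longrightarrow> D \<inter> U \<noteq> {}"
  shows "dense_in T D"
  using assms unfolding dense_in_def
  by (metis (no_types, opaque_lifting) dense_intersects_open)

lemma dense_in_Int:
  assumes "dense_in T D" "openin T U" "U \<noteq> {}"
  shows "D \<inter> U \<noteq> {}"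
  using assms unfolding dense_in_def
  by (metis (no_types, opaque_lifting) dense_intersects_open)

text \<open>An open set that misses \<open>N\<close> also misses its closure, so it cannot be a
  nonempty part of the interior of that closure.\<close>

lemma nowhere_dense_inI:
  assumes "N \<subseteq> topspace T"
    and "\<And>U. openin T U \<Longrightarrow> U \<noteq> {} \<Longrightarrow> \<exists>W. openin T W \<and> W \<noteq> {} \<and> W \<subseteq> U \<and> W \<inter> N = {}"
  shows "nowhere_dense_in T N"
  unfolding nowhere_dense_in_def
proof (intro conjI assms(1), rule ccontr)
  assume "T interior_of (T closure_of N) \<noteq> {}"
  then obtain W where W: "openin T W" "W \<noteq> {}" "W \<subseteq> T interior_of (T closure_of N)" "W \<inter> N = {}"
    using assms(2) openin_interior_of by metis
  then have "W \<inter> T closure_of N = {}"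
    by (simp add: openin_Int_closure_of_eq_empty)
  then show False
    using W interior_of_subset by fastforce
qed

section \<open>Large collections of killed sets\<close>

context separating_independent_sets
begin

definition overlaps :: "'a set set" where
  "overlaps = {C (Inl \<alpha>) \<inter> C (Inl \<beta>) | \<alpha> \<beta>. \<alpha> \<subseteq> X \<and> \<beta> \<subseteq> X \<and> \<alpha> \<noteq> \<beta>}"

text \<open>The last conjunct is the compatibility with killing the overlaps: a cell that mentions a
  coordinate reserved for an overlap \<open>B\<close> already avoids some
  \<open>C (Inl \<gamma>)\<close> containing \<open>B\<close>.\<close>

definition admissible :: "('a set + 'a set \<times> 'a \<times> 'a) set \<Rightarrow> ('a set + 'a set \<times> 'a \<times> 'a) set \<Rightarrow> bool" where
  "admissible P N \<longleftrightarrow> finite P \<and> finite N \<and> P \<union> N \<subseteq> Pow X <+> Pow X \<times> X \<times> X \<and> P \<inter> N = {} \<and>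
    (\<forall>B x y. Inr (B, x, y) \<in> P \<union> N \<longrightarrow> B \<in> overlaps \<longrightarrow> (\<exists>\<gamma>. Inl \<gamma> \<in> N \<and> B \<subseteq> C (Inl \<gamma>)))"

text \<open>On these points, killing the members of \<open>\<A>\<close> does not change any
  coordinate in \<open>P \<union> N\<close>.\<close>

definition residue :: "'a set set \<Rightarrow> ('a set + 'a set \<times> 'a \<times> 'a) set \<Rightarrow> ('a set + 'a set \<times> 'a \<times> 'a) set \<Rightarrow> 'a set" where
  "residue \<A> P N = cell X C P N - \<Union>{B \<in> \<A>. \<exists>x y. Inr (B, x, y) \<in> P \<union> N}"

definition large :: "'a set set \<Rightarrow> bool" where
  "large \<A> \<longleftrightarrow> (\<forall>P N. admissible P N \<longrightarrow> |X| \<le>o |residue \<A> P N| )"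

lemma overlaps_subset: "overlaps \<subseteq> Pow X"
  unfolding overlaps_def using subset by blast

lemma admissible_avoids:
  assumes "admissible P N" "Inr (B, x, y) \<in> P \<union> N" "B \<in> overlaps"
  obtains \<gamma> where "Inl \<gamma> \<in> N" "B \<subseteq> C (Inl \<gamma>)"
proof -
  have "\<forall>B x y. Inr (B, x, y) \<in> P \<union> N \<longrightarrow> B \<in> overlaps \<longrightarrow> (\<exists>\<gamma>. Inl \<gamma> \<in> N \<and> B \<subseteq> C (Inl \<gamma>))"
    using assms(1) unfolding admissible_def by (elim conjE)
  then show thesis
    using assms(2,3) that by metis
qed

lemma admissible_Un:
  assumes "admissible P N" "admissible P' N'" "P \<inter> N' = {}" "P' \<inter> N = {}"
  shows "admissible (P \<union> P') (N \<union> N')"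
  unfolding admissible_def
proof (intro conjI allI impI)
  show "finite (P \<union> P')" "finite (N \<union> N')"
    "(P \<union> P') \<union> (N \<union> N') \<subseteq> Pow X <+> Pow X \<times> X \<times> X"
    "(P \<union> P') \<inter> (N \<union> N') = {}"
    using assms unfolding admissible_def by auto
  fix B x y assume "Inr (B, x, y) \<in> (P \<union> P') \<union> (N \<union> N')" and B: "B \<in> overlaps"
  then consider "Inr (B, x, y) \<in> P \<union> N" | "Inr (B, x, y) \<in> P' \<union> N'"
    by blast
  then show "\<exists>\<gamma>. Inl \<gamma> \<in> N \<union> N' \<and> B \<subseteq> C (Inl \<gamma>)"
    by cases (metis UnCI admissible_avoids assms(1,2) B)+
qed

lemma residue_Int:
  "residue \<A> P N \<inter> residue \<A> P' N' = residue \<A> (P \<union> P') (N \<union> N')"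
  unfolding residue_def cell_Int[symmetric] by blast

text \<open>The starting point for Zorn's lemma: the cell of an admissible pair is already disjoint
  from every overlap to be deleted, so the residue is the whole cell and independence
  applies.\<close>

lemma large_overlaps: "large overlaps"
  unfolding large_def
proof (intro allI impI)
  fix P N assume adm: "admissible P N"
  have "cell X C P N \<subseteq> residue overlaps P N"
  proof
    fix z assume z: "z \<in> cell X C P N"
    have "z \<notin> B" if B: "B \<in> overlaps" "Inr (B, x, y) \<in> P \<union> N" for B x y
    proof -
      obtain \<gamma> where "Inl \<gamma> \<in> N" "B \<subseteq> C (Inl \<gamma>)"
        using admissible_avoids[OF adm B(2,1)] .
      then show ?thesis
        using z unfolding cell_def by blast
    qed
    then show "z \<in> residue overlaps P N"
      using z unfolding residue_def by blast
  qed
  moreover have "|X| \<le>o |cell X C P N|"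
    using adm unfolding admissible_def by (intro independent) simp_all
  ultimately show "|X| \<le>o |residue overlaps P N|"
    by (meson card_of_mono1 ordLeq_transitive)
qed

text \<open>A pair mentions only finitely many sets \<open>B\<close>; those in the union of the
  chain lie together in one member, whose largeness gives the bound.\<close>

lemma large_Union_chain:
  assumes ne: "\<C> \<noteq> {}" and chain: "subset.chain S \<C>" and large: "\<And>\<A>. \<A> \<in> \<C> \<Longrightarrow> large \<A>"
  shows "large (\<Union>\<C>)"
  unfolding large_def
proof (intro allI impI)
  fix P N assume adm: "admissible P N"
  let ?J = "{B \<in> \<Union>\<C>. \<exists>x y. Inr (B, x, y) \<in> P \<union> N}"
  \<comment> \<open>On \<open>Inl\<close> indices the value of \<open>projr\<close> is arbitrary;
    this is harmless, as only finiteness of the image matters.\<close>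
  have "?J \<subseteq> (\<lambda>i. fst (projr i)) ` (P \<union> N)"
  proof
    fix B assume "B \<in> ?J"
    then obtain x y where "Inr (B, x, y) \<in> P \<union> N"
      by blast
    then show "B \<in> (\<lambda>i. fst (projr i)) ` (P \<union> N)"
      by (intro image_eqI[of _ _ "Inr (B, x, y)"]) simp_all
  qed
  moreover have "finite (P \<union> N)"
    using adm unfolding admissible_def by simp
  ultimately have fin: "finite ?J"
    by (meson finite_imageI finite_subset)
  have sub: "?J \<subseteq> \<Union>\<C>"
    by (rule Collect_restrict)
  obtain \<A> where \<A>: "\<A> \<in> \<C>" "?J \<subseteq> \<A>"
    using finite_subset_Union_chain[OF fin sub ne chain] .
  have "residue \<A> P N \<subseteq> residue (\<Union>\<C>) P N"
    using \<A>(2) unfolding residue_def by blast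
  moreover have "|X| \<le>o |residue \<A> P N|"
    using large[OF \<A>(1)] adm unfolding large_def by simp
  ultimately show "|X| \<le>o |residue (\<Union>\<C>) P N|"
    by (meson card_of_mono1 ordLeq_transitive)
qed

text \<open>Zorn's lemma, with maximality stated for adding a single set, the form applied to dense
  sets.\<close>

lemma maximal_large_exists:
  "\<exists>\<A>. overlaps \<subseteq> \<A> \<and> large \<A> \<and> (\<forall>B. large (insert B \<A>) \<longrightarrow> B \<in> \<A>)"
proof -
  let ?S = "{\<A>. overlaps \<subseteq> \<A> \<and> large \<A>}"
  have "\<exists>\<A>\<in>?S. \<forall>\<B>\<in>?S. \<A> \<subseteq> \<B> \<longrightarrow> \<B> = \<A>"
  proof (rule subset_Zorn_nonempty)
    show "?S \<noteq> {}"
      using large_overlaps by blast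
    fix \<C> assume "\<C> \<noteq> {}" and chain: "subset.chain ?S \<C>"
    moreover have "\<C> \<subseteq> ?S"
      using chain by (simp add: subset.chain_def)
    ultimately have "large (\<Union>\<C>)"
      by (intro large_Union_chain[OF _ chain]) blast+
    then show "\<Union>\<C> \<in> ?S"
      using \<open>\<C> \<noteq> {}\<close> \<open>\<C> \<subseteq> ?S\<close> by blast
  qed
  then obtain \<A> where \<A>: "\<A> \<in> ?S" "\<forall>\<B>\<in>?S. \<A> \<subseteq> \<B> \<longrightarrow> \<B> = \<A>"
    by (rule bexE)
  have "B \<in> \<A>" if "large (insert B \<A>)" for B
  proof -
    have "insert B \<A> \<in> ?S"
      using \<A>(1) that by blast
    then show ?thesis
      using \<A>(2) by (metis insertI1 subset_insertI)
  qed
  then show ?thesis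
    using \<A>(1) by blast
qed

end

section \<open>The space given by a maximal large collection\<close>

locale maximal_large = separating_independent_sets +
  fixes \<A> :: "'a set set"
  assumes overlaps: "overlaps \<subseteq> \<A>"
    and large: "large \<A>"
    and maximal: "large (insert B \<A>) \<Longrightarrow> B \<in> \<A>"
begin

text \<open>The coordinates after killing. The sets \<open>C (Inl \<alpha>)\<close> are not among
  the clopen coordinates; they are kept as dense sets.\<close>

definition V :: "'a set \<times> 'a \<times> 'a \<Rightarrow> 'a set" where
  "V i = C (Inr i) - (if fst i \<in> \<A> then fst i else {})"

abbreviation T :: "'a topology" where
  "T \<equiv> cell_topology X (Pow X \<times> X \<times> X) V"

text \<open>The pair is made admissible by adding \<open>Inl \<alpha>\<close> positively and, for
  each overlap it mentions, some \<open>Inl \<gamma>\<close> negatively. The residue of the new pair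
  lies in the intersection and has size \<open>|X|\<close>.\<close>

lemma card_Int_cell:
  assumes \<alpha>: "\<alpha> \<subseteq> X" and fin: "finite P" "finite N" and sub: "P \<union> N \<subseteq> Pow X \<times> X \<times> X"
    and dis: "P \<inter> N = {}"
  shows "|X| \<le>o |C (Inl \<alpha>) \<inter> cell X V P N|"
proof -
  define K where "K = {i \<in> P \<union> N. fst i \<in> overlaps}"
  \<comment> \<open>An overlap lies in two sets \<open>C (Inl \<beta>)\<close>,
    \<open>C (Inl \<delta>)\<close> with \<open>\<beta> \<noteq> \<delta>\<close>, and at least one
    of these indices differs from \<open>\<alpha>\<close>.\<close>
  have ex: "\<forall>i\<in>K. \<exists>\<gamma>. \<gamma> \<subseteq> X \<and> \<gamma> \<noteq> \<alpha> \<and> fst i \<subseteq> C (Inl \<gamma>)"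
  proof
    fix i assume i: "i \<in> K"
    obtain \<beta> \<delta> where "fst i = C (Inl \<beta>) \<inter> C (Inl \<delta>)" "\<beta> \<subseteq> X" "\<delta> \<subseteq> X" "\<beta> \<noteq> \<delta>"
      using i unfolding K_def overlaps_def by blast
    then show "\<exists>\<gamma>. \<gamma> \<subseteq> X \<and> \<gamma> \<noteq> \<alpha> \<and> fst i \<subseteq> C (Inl \<gamma>)"
      by (metis Int_lower1 Int_lower2)
  qed
  obtain \<gamma> where \<gamma>: "\<forall>i\<in>K. \<gamma> i \<subseteq> X \<and> \<gamma> i \<noteq> \<alpha> \<and> fst i \<subseteq> C (Inl (\<gamma> i))"
    using bchoice[OF ex] by (rule exE)
  let ?P = "insert (Inl \<alpha>) (Inr ` P)" and ?N = "(\<lambda>i. Inl (\<gamma> i)) ` K \<union> Inr ` N"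
  have "admissible ?P ?N"
    unfolding admissible_def
  proof (intro conjI allI impI)
    show "finite ?P" "finite ?N"
      using fin by (simp_all add: K_def)
    have "Inl \<alpha> \<in> Pow X <+> Pow X \<times> X \<times> X" "Inr ` (P \<union> N) \<subseteq> Pow X <+> Pow X \<times> X \<times> X"
      using \<alpha> sub by blast+
    moreover have "(\<lambda>i. Inl (\<gamma> i)) ` K \<subseteq> Pow X <+> Pow X \<times> X \<times> X"
      using \<gamma> by blast
    ultimately show "?P \<union> ?N \<subseteq> Pow X <+> Pow X \<times> X \<times> X"
      by blast
    have "Inl \<alpha> \<notin> ?N"
      using \<gamma> by blast
    moreover have "Inr ` P \<inter> ?N = {}"
      using dis by blast
    ultimately show "?P \<inter> ?N = {}"
      by blast
    fix B x y assume "Inr (B, x, y) \<in> ?P \<union> ?N" "B \<in> overlaps"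
    then have K: "(B, x, y) \<in> K"
      unfolding K_def by auto
    then have "B \<subseteq> C (Inl (\<gamma> (B, x, y)))"
      using \<gamma> by force
    moreover have "Inl (\<gamma> (B, x, y)) \<in> ?N"
      using K by blast
    ultimately show "\<exists>\<gamma>. Inl \<gamma> \<in> ?N \<and> B \<subseteq> C (Inl \<gamma>)"
      by blast
  qed
  then have "|X| \<le>o |residue \<A> ?P ?N|"
    using large unfolding large_def by blast
  moreover have "residue \<A> ?P ?N \<subseteq> C (Inl \<alpha>) \<inter> cell X V P N"
  proof
    fix z assume z: "z \<in> residue \<A> ?P ?N"
    then have cell: "z \<in> cell X C ?P ?N"
      unfolding residue_def by blast
    have "z \<in> V i" if "i \<in> P" for i
    proof -
      obtain B x y where i: "i = (B, x, y)"
        by (cases i)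
      then have "Inr (B, x, y) \<in> ?P"
        using that by blast
      then have "B \<in> \<A> \<longrightarrow> z \<notin> B"
        using z unfolding residue_def by blast
      moreover have "z \<in> C (Inr i)"
        using cell that unfolding cell_def by blast
      ultimately show ?thesis
        by (simp add: V_def i)
    qed
    moreover have "z \<notin> V i" if "i \<in> N" for i
      using cell that unfolding cell_def V_def by blast
    ultimately show "z \<in> C (Inl \<alpha>) \<inter> cell X V P N"
      using cell unfolding cell_def by blast
  qed
  ultimately show ?thesis
    by (meson card_of_mono1 ordLeq_transitive)
qed

lemma cell_nonempty:
  assumes "finite P" "finite N" "P \<union> N \<subseteq> Pow X \<times> X \<times> X" "P \<inter> N = {}"
  shows "cell X V P N \<noteq> {}"
proof
  assume "cell X V P N = {}"
  then have "|X| \<le>o |{} :: 'a set|"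
    using card_Int_cell[OF empty_subsetI assms] by simp
  then show False
    using infinite card_of_ordLeq_finite finite.emptyI by metis
qed

lemma card_Int_open:
  assumes "\<alpha> \<subseteq> X" "openin T U" "U \<noteq> {}"
  shows "|X| \<le>o |C (Inl \<alpha>) \<inter> U|"
proof -
  obtain x where x: "x \<in> U"
    using assms(3) by blast
  obtain P N where PN: "finite P" "finite N" "P \<union> N \<subseteq> Pow X \<times> X \<times> X" "P \<inter> N = {}"
    "x \<in> cell X V P N" "cell X V P N \<subseteq> U"
    using cell_topology_neighbourhood[OF assms(2) x] .
  then have "|C (Inl \<alpha>) \<inter> cell X V P N| \<le>o |C (Inl \<alpha>) \<inter> U|"
    using PN(6) by (intro card_of_mono1) blast
  with card_Int_cell[OF assms(1) PN(1-4)] show ?thesis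
    by (rule ordLeq_transitive)
qed

lemma dense_C:
  assumes "\<alpha> \<subseteq> X"
  shows "dense_in T (C (Inl \<alpha>))"
proof (rule dense_inI)
  show "C (Inl \<alpha>) \<subseteq> topspace T"
    using subset by simp
  fix U assume "openin T U" "U \<noteq> {}"
  then have "|X| \<le>o |C (Inl \<alpha>) \<inter> U|"
    by (rule card_Int_open[OF assms])
  then show "C (Inl \<alpha>) \<inter> U \<noteq> {}"
    using infinite card_of_ordLeq_finite finite.emptyI by metis
qed

lemma dispersion_character_T: "dispersion_character T =o |X|"
proof -
  have "dispersion_character T =o |topspace T|"
  proof (rule dispersion_character_eq)
    show "topspace T \<noteq> {}"
      using infinite by auto
    fix U assume "openin T U" "U \<noteq> {}"
    then have "|X| \<le>o |C (Inl {}) \<inter> U|"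
      by (intro card_Int_open) simp_all
    moreover have "|C (Inl {}) \<inter> U| \<le>o |U|"
      by (rule card_of_mono1) blast
    ultimately show "|topspace T| \<le>o |U|"
      unfolding topspace_cell_topology by (rule ordLeq_transitive)
  qed
  then show ?thesis
    by simp
qed

text \<open>Infinitely many coordinates are reserved for \<open>B\<close>, so a basic open set can
  be cut down by one that it does not mention. The smaller cell is nonempty and misses
  \<open>B\<close>, because \<open>B\<close> is killed.\<close>

lemma nowhere_dense_overlap:
  assumes B: "B \<in> overlaps"
  shows "nowhere_dense_in T B"
proof (rule nowhere_dense_inI)
  have BX: "B \<subseteq> X"
    using B overlaps_subset by blast
  then show "B \<subseteq> topspace T"
    by simp
  fix U assume U: "openin T U" "U \<noteq> {}"
  then obtain x where x: "x \<in> U"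
    by blast
  obtain P N where PN: "finite P" "finite N" "P \<union> N \<subseteq> Pow X \<times> X \<times> X" "P \<inter> N = {}"
    "x \<in> cell X V P N" "cell X V P N \<subseteq> U"
    using cell_topology_neighbourhood[OF U(1) x] .
  obtain y where y: "y \<in> X"
    using infinite by fastforce
  have "infinite ((\<lambda>x. (B, x, y)) ` X)"
    using infinite by (simp add: finite_image_iff inj_on_def)
  then obtain i where i: "i \<in> (\<lambda>x. (B, x, y)) ` X" "i \<notin> P \<union> N"
    using PN(1,2) by (meson finite_UnI finite_subset subsetI)
  then have iI: "i \<in> Pow X \<times> X \<times> X" and "fst i = B"
    using BX y by auto
  then have V: "V i \<inter> B = {}"
    using B overlaps unfolding V_def by auto
  let ?W = "cell X V (insert i P) N"
  show "\<exists>W. openin T W \<and> W \<noteq> {} \<and> W \<subseteq> U \<and> W \<inter> B = {}"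
  proof (intro exI conjI)
    show "openin T ?W"
      using PN iI by (intro openin_cell) auto
    show "?W \<noteq> {}"
      using PN iI i(2) by (intro cell_nonempty) auto
    have "?W \<subseteq> cell X V P N"
      unfolding cell_def by blast
    then show "?W \<subseteq> U"
      using PN(6) by blast
    show "?W \<inter> B = {}"
      using V unfolding cell_def by blast
  qed
qed

text \<open>If two of the sets coincided, a cell would be empty, against independence. Hence there
  are \<open>|Pow X|\<close> dense sets, at least the successor of \<open>|X|\<close>.\<close>

lemma inj_on_C: "inj_on (\<lambda>\<alpha>. C (Inl \<alpha>)) (Pow X)"
proof (rule inj_onI, rule ccontr)
  fix \<alpha> \<beta> assume *: "\<alpha> \<in> Pow X" "\<beta> \<in> Pow X" "C (Inl \<alpha>) = C (Inl \<beta>)" "\<alpha> \<noteq> \<beta>"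
  have "|X| \<le>o |cell X C {Inl \<alpha>} {Inl \<beta>}|"
    using * by (intro independent) auto
  moreover have "cell X C {Inl \<alpha>} {Inl \<beta>} = {}"
    using *(3) unfolding cell_def by blast
  ultimately show False
    using infinite card_of_ordLeq_finite finite.emptyI by metis
qed

lemma extraresolvable_T: "extraresolvable T"
proof -
  have "cardSuc (dispersion_character T) =o cardSuc |X|"
    using dispersion_character_T
    by (intro iffD2[OF cardSuc_invar_ordIso]) (auto simp: dispersion_character_def card_of_Card_order)
  moreover have "cardSuc |X| \<le>o |(\<lambda>\<alpha>. C (Inl \<alpha>)) ` Pow X|"
  proof -
    have "cardSuc |X| \<le>o |Pow X|"
      using cardSuc_ordLess_ordLeq[OF card_of_Card_order card_of_Card_order] card_of_Pow by blast
    moreover have "|Pow X| \<le>o |(\<lambda>\<alpha>. C (Inl \<alpha>)) ` Pow X|"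
      using inj_on_C card_of_ordLeq subset_refl by blast
    ultimately show ?thesis
      by (rule ordLeq_transitive)
  qed
  ultimately have "cardSuc (dispersion_character T) \<le>o |(\<lambda>\<alpha>. C (Inl \<alpha>)) ` Pow X|"
    by (rule ordIso_ordLeq_trans)
  moreover have "Card_order (cardSuc (dispersion_character T))"
    by (intro cardSuc_Card_order) (simp add: dispersion_character_def card_of_Card_order)
  then have iso: "|Field (cardSuc (dispersion_character T))| =o cardSuc (dispersion_character T)"
    by (rule card_of_Field_ordIso)
  ultimately have "|Field (cardSuc (dispersion_character T))| \<le>o |(\<lambda>\<alpha>. C (Inl \<alpha>)) ` Pow X|"
    by (meson ordIso_ordLeq_trans)
  \<comment> \<open>\<open>extraresolvable\<close> asks for exactly the successor cardinal, so a
    subfamily of that size is selected.\<close>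
  then have "\<exists>\<D>\<subseteq>(\<lambda>\<alpha>. C (Inl \<alpha>)) ` Pow X. |Field (cardSuc (dispersion_character T))| =o |\<D>|
      \<and> |\<D>| \<le>o |(\<lambda>\<alpha>. C (Inl \<alpha>)) ` Pow X|"
    by (rule iffD1[OF internalize_card_of_ordLeq2])
  then obtain \<D> where \<D>: "\<D> \<subseteq> (\<lambda>\<alpha>. C (Inl \<alpha>)) ` Pow X"
    "|Field (cardSuc (dispersion_character T))| =o |\<D>|"
    by (elim exE conjE)
  show ?thesis
    unfolding extraresolvable_def
  proof (intro exI conjI)
    show "|\<D>| =o cardSuc (dispersion_character T)"
      using ordIso_symmetric[OF \<D>(2)] iso by (rule ordIso_transitive)
    show "\<forall>D\<in>\<D>. dense_in T D"
      using \<D>(1) dense_C by blast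
    show "pairwise (\<lambda>D E. nowhere_dense_in T (D \<inter> E)) \<D>"
    proof (rule pairwiseI)
      fix D E assume "D \<in> \<D>" "E \<in> \<D>" "D \<noteq> E"
      then have "D \<inter> E \<in> overlaps"
        using \<D>(1) unfolding overlaps_def by blast
      then show "nowhere_dense_in T (D \<inter> E)"
        by (rule nowhere_dense_overlap)
    qed
  qed
qed

text \<open>A killed \<open>D\<close> misses the nonempty open set given by any coordinate reserved
  for \<open>D\<close>, here the one with index \<open>(D, x, x)\<close>.\<close>

lemma dense_notin:
  assumes "dense_in T D"
  shows "D \<notin> \<A>"
proof
  assume D: "D \<in> \<A>"
  obtain x where x: "x \<in> X"
    using infinite by fastforce
  have DX: "D \<subseteq> X"
    using assms unfolding dense_in_def by simp
  let ?U = "cell X V {(D, x, x)} {}"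
  have "openin T ?U"
    using x DX by (intro openin_cell) auto
  moreover have "?U \<noteq> {}"
    using x DX by (intro cell_nonempty) auto
  ultimately have "D \<inter> ?U \<noteq> {}"
    by (rule dense_in_Int[OF assms])
  then show False
    using D unfolding cell_def V_def by auto
qed

lemma not_resolvable_T: "\<not> resolvable omega_1 T"
proof
  assume "resolvable omega_1 T"
  then obtain \<D> where \<D>: "|\<D>| =o omega_1" "\<forall>D\<in>\<D>. dense_in T D" "pairwise disjnt \<D>"
    unfolding resolvable_def by blast
  have unc: "uncountable \<D>"
  proof
    assume "countable \<D>"
    then have "|\<D>| \<le>o natLeq"
      by (simp add: countable_card_le_natLeq)
    then have "omega_1 \<le>o natLeq"
      using \<D>(1) by (meson ordIso_symmetric ordIso_ordLeq_trans)
    moreover have "natLeq <o omega_1"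
      by (rule cardSuc_greater[OF natLeq_Card_order])
    ultimately show False
      by (meson not_ordLess_ordLeq)
  qed
  \<comment> \<open>Maximality: adding \<open>D\<close> to \<open>\<A>\<close> destroys largeness at
    some admissible pair, so \<open>D\<close> contains all but fewer than \<open>|X|\<close> points
    of the residue of \<open>\<A>\<close> at that pair.\<close>
  have ex: "\<forall>D\<in>\<D>. \<exists>z. admissible (fst z) (snd z) \<and> |residue (insert D \<A>) (fst z) (snd z)| <o |X|"
  proof
    fix D assume D: "D \<in> \<D>"
    have "D \<notin> \<A>"
      using D \<D>(2) dense_notin by blast
    then have "\<not> large (insert D \<A>)"
      using maximal by blast
    then obtain P N where "admissible P N" "\<not> |X| \<le>o |residue (insert D \<A>) P N|"
      unfolding large_def by blast
    moreover from this(2) have "|residue (insert D \<A>) P N| <o |X|"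
      by (rule iffD1[OF not_ordLeq_iff_ordLess[OF card_of_Well_order card_of_Well_order]])
    ultimately show "\<exists>z. admissible (fst z) (snd z) \<and> |residue (insert D \<A>) (fst z) (snd z)| <o |X|"
      by (intro exI[of _ "(P, N)"]) simp
  qed
  obtain f where f:
    "\<forall>D\<in>\<D>. admissible (fst (f D)) (snd (f D)) \<and> |residue (insert D \<A>) (fst (f D)) (snd (f D))| <o |X|"
    using bchoice[OF ex] by (rule exE)
  define p q where "p D = fst (f D)" and "q D = snd (f D)" for D
  have pq: "admissible (p D) (q D)" "|residue (insert D \<A>) (p D) (q D)| <o |X|" if "D \<in> \<D>" for D
    using f that unfolding p_def q_def by blast+
  have "\<exists>D\<in>\<D>. \<exists>E\<in>\<D>. D \<noteq> E \<and> p D \<inter> q E = {} \<and> p E \<inter> q D = {}"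
  proof -
    have "finite (p D) \<and> finite (q D) \<and> p D \<inter> q D = {}" if "D \<in> \<D>" for D
      using pq(1)[OF that] unfolding admissible_def by blast
    from compatible_pair[OF unc this] show ?thesis .
  qed
  then obtain D E where DE: "D \<in> \<D>" "E \<in> \<D>" "D \<noteq> E" "p D \<inter> q E = {}" "p E \<inter> q D = {}"
    by blast
  let ?D = "residue (insert D \<A>) (p D) (q D)" and ?E = "residue (insert E \<A>) (p E) (q E)"
  have "|X| \<le>o |residue \<A> (p D \<union> p E) (q D \<union> q E)|"
    using large admissible_Un[OF pq(1) pq(1)] DE unfolding large_def by blast
  \<comment> \<open>A point of the common residue lies outside \<open>D\<close> or outside
    \<open>E\<close>, as these are disjoint, and so in one of two sets of size below
    \<open>|X|\<close>.\<close>
  moreover have "residue \<A> (p D \<union> p E) (q D \<union> q E) \<subseteq> ?D \<union> ?E"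
  proof -
    have "D \<inter> E = {}"
      using \<D>(3) DE(1-3) by (simp add: pairwise_def disjnt_def)
    moreover have "residue \<A> (p D) (q D) - D \<subseteq> ?D" "residue \<A> (p E) (q E) - E \<subseteq> ?E"
      unfolding residue_def by blast+
    ultimately show ?thesis
      unfolding residue_Int[symmetric] by blast
  qed
  ultimately have "|X| \<le>o |?D \<union> ?E|"
    by (meson card_of_mono1 ordLeq_transitive)
  moreover have "|?D \<union> ?E| <o |X|"
    using pq(2) DE(1,2) infinite by (intro card_of_Un_ordLess_infinite)
  ultimately show False
    by (meson not_ordLess_ordLeq)
qed

text \<open>Killing the empty set removes nothing, so its reserved coordinates still separate
  points.\<close>

lemma Hausdorff_T: "Hausdorff_space T"
proof (rule Hausdorff_cell_topology)
  fix x y assume xy: "x \<in> X" "y \<in> X" "x \<noteq> y"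
  then show "\<exists>i\<in>Pow X \<times> X \<times> X. x \<in> V i \<and> y \<notin> V i"
    using separating[OF xy] unfolding V_def by (intro bexI[of _ "({}, x, y)"]) auto
qed

end

theorem theorem2:
  fixes \<kappa> :: "'a rel"
  assumes "Card_order \<kappa>" and "cinfinite \<kappa>"
  shows "\<exists>X :: 'a topology.
           topspace X \<noteq> {} \<and> zero_dimensional X \<and> Hausdorff_space X \<and>
           dispersion_character X =o \<kappa> \<and>
           extraresolvable X \<and> \<not> resolvable omega_1 X"
proof -
  have inf: "infinite (Field \<kappa>)"
    using assms(2) by (simp add: cinfinite_def)
  obtain C where "separating_independent_sets (Field \<kappa>) C"
    using separating_independent_sets_exist[OF inf] by (rule exE)
  then interpret separating_independent_sets "Field \<kappa>" C .
  obtain \<A> where \<A>: "overlaps \<subseteq> \<A> \<and> large \<A> \<and>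
      (\<forall>B. large (insert B \<A>) \<longrightarrow> B \<in> \<A>)"
    using maximal_large_exists by (rule exE)
  interpret maximal_large "Field \<kappa>" C \<A>
    by unfold_locales (use \<A> in simp_all)
  \<comment> \<open>The points of the space are those of \<open>Field \<kappa>\<close>, which has
    cardinality \<open>\<kappa>\<close> because \<open>\<kappa>\<close> is a cardinal order.\<close>
  have "dispersion_character T =o \<kappa>"
    using dispersion_character_T card_of_Field_ordIso[OF assms(1)] by (rule ordIso_transitive)
  moreover have "topspace T \<noteq> {}"
    using inf by auto
  ultimately show ?thesis
    using zero_dimensional_cell_topology Hausdorff_T extraresolvable_T not_resolvable_T by blast
qed

end
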